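(* Let $R$ be an associative ring with unity and let $I$ be an ideal of $R$. Then $I$ is a weak nil clean ideal of $R$ if and only if for every $x\in I$ there exist $e\in \mathrm{Idem}(I)$ and $n\in \mathrm{Nil}(I)$ such that $x=e+n$ or $x=-e+n$.
   Context: $\mathrm{Idem}(R)$ and $\mathrm{Nil}(R)$ denote the sets of idempotent elements and nilpotent elements of $R$. Ideals are two-sided. For an ideal $I$ of $R$, $\mathrm{Idem}(I)=I\cap \mathrm{Idem}(R)$ and $\mathrm{Nil}(I)=I\cap \mathrm{Nil}(R)$. An ideal $I$ of $R$ is called a weak nil clean ideal of $R$ if for every $x\in I$ there exist $e\in \mathrm{Idem}(R)$ and $n\in \mathrm{Nil}(R)$ such that $x=e+n$ or $x=-e+n$. *)

theory Defs
  imports "HOL-Algebra.Ideal"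
begin

definition idempotents :: "('a, 'b) ring_scheme \<Rightarrow> 'a set" where
  "idempotents R = {e \<in> carrier R. e \<otimes>\<^bsub>R\<^esub> e = e}"

definition nilpotents :: "('a, 'b) ring_scheme \<Rightarrow> 'a set" where
  "nilpotents R = {x \<in> carrier R. \<exists>k::nat. k > 0 \<and> x [^]\<^bsub>R\<^esub> k = \<zero>\<^bsub>R\<^esub>}"

definition idempotents_of_ideal :: "('a, 'b) ring_scheme \<Rightarrow> 'a set \<Rightarrow> 'a set" where
  "idempotents_of_ideal R I = I \<inter> idempotents R"

definition nilpotents_of_ideal :: "('a, 'b) ring_scheme \<Rightarrow> 'a set \<Rightarrow> 'a set" where
  "nilpotents_of_ideal R I = I \<inter> nilpotents R"

text \<open>The locale \<^locale>\<open>ideal\<close> consists of the two-sided ideals of a (not necessarily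
  commutative) ring with unity. The idempotent and the nilpotent element below are taken
  in the whole ring, not in the ideal.\<close>

definition weak_nil_clean_ideal :: "'a set \<Rightarrow> ('a, 'b) ring_scheme \<Rightarrow> bool" where
  "weak_nil_clean_ideal I R \<longleftrightarrow> ideal I R \<and>
    (\<forall>x\<in>I. \<exists>e\<in>idempotents R. \<exists>n\<in>nilpotents R.
      x = e \<oplus>\<^bsub>R\<^esub> n \<or> x = (\<ominus>\<^bsub>R\<^esub> e) \<oplus>\<^bsub>R\<^esub> n)"

end

theory Submission
  imports Defs
begin

text \<open>Suppose \<open>x = \<plusminus>e + n\<close> lies in \<open>I\<close>. Multiplying by \<open>e\<close> on the left and by \<open>n\<^sup>j\<close> on the
  right gives \<open>e n\<^sup>j \<equiv> \<minusplus>e n\<^sup>j\<^sup>+\<^sup>1\<close> modulo \<open>I\<close>, so a descent starting from \<open>n\<^sup>k = 0\<close> ends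
  with \<open>e \<in> I\<close>, and then \<open>n \<in> I\<close> as well.\<close>

context ideal
begin

text \<open>One step of the descent. Since \<open>e\<close> and \<open>n\<close> need not commute,
  \<open>e\<close> acts from the left and the power from the right; \<open>I\<close> absorbs both
  because it is two-sided.\<close>

lemma idempotent_times_pow_descent:
  fixes j :: nat
  assumes e: "e \<in> carrier R" "e \<otimes> e = e" and n: "n \<in> carrier R"
    and x: "e \<oplus> n \<in> I \<or> \<ominus> e \<oplus> n \<in> I"
    and step: "e \<otimes> n [^] Suc j \<in> I"
  shows "e \<otimes> n [^] j \<in> I"
proof -
  define p where "p = n [^] j"
  have p: "p \<in> carrier R" using n by (simp add: p_def)
  \<comment> \<open>The extra factor \<open>n\<close> is moved to the left of the power, where it
    occurs when \<open>e \<otimes> (e \<oplus> n) \<otimes> p\<close> is expanded.\<close>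
  have enp: "e \<otimes> (n \<otimes> p) \<in> I"
    using step nat_pow_Suc2[OF n, of j] by (simp add: p_def)
  from x have "e \<otimes> p \<in> I"
  proof
    assume "e \<oplus> n \<in> I"
    then have "e \<otimes> (e \<oplus> n) \<otimes> p \<in> I"
      using e p by (simp add: I_l_closed I_r_closed)
    also have "e \<otimes> (e \<oplus> n) \<otimes> p = e \<otimes> e \<otimes> p \<oplus> e \<otimes> (n \<otimes> p)"
      using e(1) n p by (simp add: r_distr l_distr m_assoc)
    \<comment> \<open>Idempotence turns \<open>e \<otimes> e \<otimes> p\<close> into
      \<open>e \<otimes> p\<close>; subtracting the known member
      \<open>e \<otimes> (n \<otimes> p)\<close> isolates it.\<close>
    finally have "(e \<otimes> p \<oplus> e \<otimes> (n \<otimes> p)) \<oplus> \<ominus> (e \<otimes> (n \<otimes> p)) \<in> I"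
      using e enp by simp
    moreover have "(e \<otimes> p \<oplus> e \<otimes> (n \<otimes> p)) \<oplus> \<ominus> (e \<otimes> (n \<otimes> p)) = e \<otimes> p"
      using e(1) n p by algebra
    ultimately show ?thesis by simp
  next
    assume "\<ominus> e \<oplus> n \<in> I"
    then have "e \<otimes> (\<ominus> e \<oplus> n) \<otimes> p \<in> I"
      using e p by (simp add: I_l_closed I_r_closed)
    also have "e \<otimes> (\<ominus> e \<oplus> n) \<otimes> p = \<ominus> (e \<otimes> e \<otimes> p) \<oplus> e \<otimes> (n \<otimes> p)"
      using e(1) n p by (simp add: r_distr l_distr m_assoc r_minus l_minus)
    \<comment> \<open>The subtraction is reversed here, so that \<open>e \<otimes> p\<close> comes
      out with a positive sign.\<close>
    finally have "e \<otimes> (n \<otimes> p) \<oplus> \<ominus> (\<ominus> (e \<otimes> p) \<oplus> e \<otimes> (n \<otimes> p)) \<in> I"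
      using e enp by simp
    moreover have "e \<otimes> (n \<otimes> p) \<oplus> \<ominus> (\<ominus> (e \<otimes> p) \<oplus> e \<otimes> (n \<otimes> p)) = e \<otimes> p"
      using e(1) n p by algebra
    ultimately show ?thesis by simp
  qed
  then show ?thesis by (simp add: p_def)
qed

lemma idempotent_in_ideal:
  assumes e: "e \<in> idempotents R" and n: "n \<in> nilpotents R"
    and x: "e \<oplus> n \<in> I \<or> \<ominus> e \<oplus> n \<in> I"
  shows "e \<in> I"
proof -
  from e have e': "e \<in> carrier R" "e \<otimes> e = e" by (auto simp: idempotents_def)
  from n obtain k :: nat where n': "n \<in> carrier R" and k: "n [^] k = \<zero>"
    by (auto simp: nilpotents_def)
  have "e \<otimes> n [^] k \<in> I" using k e' by simp
  \<comment> \<open>The descent stops at exponent 0, where \<open>n [^] 0\<close> is the unit and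
    the product is \<open>e\<close> itself.\<close>
  moreover have "e \<otimes> n [^] j \<in> I \<Longrightarrow> e \<in> I" for j :: nat
  proof (induction j)
    case 0
    then show ?case using e' by simp
  next
    case (Suc j)
    then show ?case using idempotent_times_pow_descent[OF e' n' x] by blast
  qed
  ultimately show ?thesis by blast
qed

lemma nilpotent_in_ideal:
  assumes "e \<in> idempotents R" and "n \<in> nilpotents R"
    and "e \<oplus> n \<in> I \<or> \<ominus> e \<oplus> n \<in> I"
  shows "n \<in> I"
proof -
  have c: "e \<in> carrier R" "n \<in> carrier R"
    using assms by (auto simp: idempotents_def nilpotents_def)
  have "e \<in> I" using idempotent_in_ideal[OF assms] .
  \<comment> \<open>Either sum cancels to \<open>n\<close>.\<close>
  with assms(3) have "\<ominus> e \<oplus> (e \<oplus> n) \<in> I \<or> e \<oplus> (\<ominus> e \<oplus> n) \<in> I" by auto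
  then show ?thesis using c by (simp add: r_neg1 r_neg2)
qed

end

theorem theorem2p9:
  fixes R :: "('a, 'b) ring_scheme" and I :: "'a set"
  assumes "ring R" and "ideal I R"
  shows "weak_nil_clean_ideal I R \<longleftrightarrow>
    (\<forall>x\<in>I. \<exists>e\<in>idempotents_of_ideal R I. \<exists>n\<in>nilpotents_of_ideal R I.
      x = e \<oplus>\<^bsub>R\<^esub> n \<or> x = (\<ominus>\<^bsub>R\<^esub> e) \<oplus>\<^bsub>R\<^esub> n)"
proof -
  interpret ideal I R by fact
  \<comment> \<open>Every decomposition over \<open>R\<close> of an element of \<open>I\<close>
    already lies in \<open>I\<close>, so the same witnesses serve in both directions.\<close>
  have "e \<in> I \<and> n \<in> I"
    if "x \<in> I" "e \<in> idempotents R" "n \<in> nilpotents R"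
      "x = e \<oplus>\<^bsub>R\<^esub> n \<or> x = (\<ominus>\<^bsub>R\<^esub> e) \<oplus>\<^bsub>R\<^esub> n" for x e n
    using that idempotent_in_ideal nilpotent_in_ideal by blast
  then show ?thesis
    using assms(2)
    unfolding weak_nil_clean_ideal_def idempotents_of_ideal_def nilpotents_of_ideal_def
    by (meson IntD2 IntI)
qed

end
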